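(* Let $q$ be a prime power, $n\ge 1$, and $k\in\mathbb{N}$ with $\gcd(q,k)=1$. Let $\beta$ be a proper element of $\mathbb{F}_{q^n}$ and let $\chi_{\beta^k}\in\mathbb{F}_q[X]$ be the characteristic polynomial of $\beta^k\in\mathbb{F}_{q^n}$ over $\mathbb{F}_q$. Then, for a positive integer $t$, we have $\chi_{\beta^k}=(m_{\beta^k})^t$ if and only if every root (in an extension field of $\mathbb{F}_q$) of the polynomial $\chi_{\beta^k}(X^k)$ has multiplicity $t$.
   Context: $\mathbb{F}_q$ is the finite field with $q$ elements. An element $\beta$ is a proper element of $\mathbb{F}_{q^n}$ if $\beta\in\mathbb{F}_{q^n}$ and $\beta$ lies in no proper subfield of $\mathbb{F}_{q^n}$. For $\gamma\in\mathbb{F}_{q^n}$, $m_\gamma\in\mathbb{F}_q[X]$ denotes the minimal polynomial of $\gamma$ over $\mathbb{F}_q$ and the characteristic polynomial of $\gamma$ over $\mathbb{F}_q$ is the degree-$n$ polynomial $\prod_{i=0}^{n-1}(X-\gamma^{q^i})$.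
   Formalization: The case β = 0 with k > 1 (possible only when q^n is prime) is excluded, because the claim fails there: for q = 2, n = 1, β = 0, k = 3, t = 1 we have χ = m = X, but X^3 has the root 0 with multiplicity 3. *)

theory Defs
  imports
    "HOL-Library.Cardinality"
    "HOL-Computational_Algebra.Computational_Algebra"
    "HOL-Number_Theory.Prime_Powers"
    "HOL-Number_Theory.Residues"
    "HOL-Algebra.Algebraic_Closure_Type"
begin

text \<open>
  The field with \<open>q\<close> elements is a type \<open>'a :: finite_field\<close> with \<open>CARD('a) = q\<close>; it is embedded
  into its algebraic closure \<open>'a alg_closure\<close> by \<^const>\<open>to_ac\<close>. The field with \<open>q ^ n\<close> elements is
  a subfield of \<open>'a alg_closure\<close> of that cardinality.
\<close>

abbreviation closure_ring :: "'a::field alg_closure ring" where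
  "closure_ring \<equiv> ring_of_type_algebra"

definition proper_element :: "'a::field alg_closure \<Rightarrow> 'a alg_closure set \<Rightarrow> bool" where
  "proper_element \<beta> L \<longleftrightarrow> \<beta> \<in> L \<and> (\<forall>S. subfield S closure_ring \<and> S \<subset> L \<longrightarrow> \<beta> \<notin> S)"

definition is_minimal_poly :: "'a::field alg_closure \<Rightarrow> 'a poly \<Rightarrow> bool" where
  "is_minimal_poly \<gamma> p \<longleftrightarrow>
     lead_coeff p = 1 \<and> poly (map_poly to_ac p) \<gamma> = 0 \<and>
     (\<forall>r. r \<noteq> 0 \<longrightarrow> poly (map_poly to_ac r) \<gamma> = 0 \<longrightarrow> degree p \<le> degree r)"

definition minimal_poly :: "'a::field alg_closure \<Rightarrow> 'a poly" where
  "minimal_poly \<gamma> = (THE p. is_minimal_poly \<gamma> p)"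

definition conjugate_prod :: "nat \<Rightarrow> 'a::finite_field alg_closure \<Rightarrow> 'a alg_closure poly" where
  "conjugate_prod n \<gamma> = (\<Prod>i<n. [:- (\<gamma> ^ (CARD('a) ^ i)), 1:])"

text \<open>
  The product of the conjugates has coefficients in the base field only if \<open>\<gamma>\<close> lies in the field
  with \<open>q ^ n\<close> elements; see \<open>to_ac_characteristic_poly\<close> below. Outside that field the
  definition has no meaning, because \<^const>\<open>of_ac\<close> is \<open>0\<close> off the range of \<^const>\<open>to_ac\<close>.
\<close>

definition characteristic_poly :: "nat \<Rightarrow> 'a::finite_field alg_closure \<Rightarrow> 'a poly" where
  "characteristic_poly n \<gamma> = map_poly of_ac (conjugate_prod n \<gamma>)"

lemma map_poly_to_ac_diff: "map_poly to_ac (p - r) = map_poly to_ac p - map_poly to_ac r"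
  by (rule poly_eqI) (simp add: coeff_map_poly)

lemma map_poly_to_ac_smult: "map_poly to_ac (smult c p) = smult (to_ac c) (map_poly to_ac p)"
  by (rule poly_eqI) (simp add: coeff_map_poly)

lemma is_minimal_poly_exists: "\<exists>p. is_minimal_poly \<gamma> p"
proof -
  define P where "P = (\<lambda>r. r \<noteq> 0 \<and> poly (map_poly to_ac r) \<gamma> = 0)"
  obtain r0 where "P r0"
    using alg_closure_algebraic[of \<gamma>] unfolding P_def by metis
  then obtain r where r: "P r" and min: "\<And>s. P s \<Longrightarrow> degree r \<le> degree s"
    using ex_has_least_nat[of P r0 degree] by blast
  have "is_minimal_poly \<gamma> (smult (inverse (lead_coeff r)) r)"
    using r min unfolding is_minimal_poly_def P_def
    by (auto simp: map_poly_to_ac_smult)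
  thus ?thesis ..
qed

lemma is_minimal_poly_unique:
  assumes "is_minimal_poly \<gamma> p" "is_minimal_poly \<gamma> r"
  shows   "p = r"
proof (rule ccontr)
  assume ne: "p \<noteq> r"
  have deg: "degree p = degree r"
    using assms unfolding is_minimal_poly_def
    by (metis antisym leading_coeff_0_iff zero_neq_one)
  have "coeff (p - r) (degree p) = 0"
    using assms deg unfolding is_minimal_poly_def by simp
  moreover have "degree (p - r) \<le> degree p"
    using deg by (simp add: degree_diff_le)
  moreover have "p - r \<noteq> 0"
    using ne by simp
  ultimately have lt: "degree (p - r) < degree p"
    by (metis le_neq_implies_less leading_coeff_0_iff)
  have "poly (map_poly to_ac (p - r)) \<gamma> = 0"
    using assms unfolding is_minimal_poly_def by (simp add: map_poly_to_ac_diff)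
  hence "degree p \<le> degree (p - r)"
    using assms \<open>p - r \<noteq> 0\<close> unfolding is_minimal_poly_def by blast
  thus False
    using lt by simp
qed

lemma minimal_poly: "is_minimal_poly \<gamma> (minimal_poly \<gamma>)"
  unfolding minimal_poly_def
  using is_minimal_poly_exists is_minimal_poly_unique by (metis theI)

lemma subfield_closure_ringD:
  assumes "subfield L (closure_ring :: 'a::field alg_closure ring)"
  shows   "1 \<in> L" "0 \<in> L" "x \<in> L \<Longrightarrow> y \<in> L \<Longrightarrow> x * y \<in> L" 
          "x \<in> L \<Longrightarrow> x \<noteq> 0 \<Longrightarrow> inverse x \<in> L"
proof -
  have sr: "subring L closure_ring"
    using assms by (simp add: subfield_def subdomain_def subcring_def)
  show "1 \<in> L" "0 \<in> L" "x \<in> L \<Longrightarrow> y \<in> L \<Longrightarrow> x * y \<in> L"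
    using subringE(2,3)[OF sr] subringE(6)[OF sr] by (auto simp: ring_of_type_algebra_def)
  assume x: "x \<in> L" "x \<noteq> 0"
  hence "x \<in> Units (closure_ring \<lparr>carrier := L\<rparr>)"
    using subfield.subfield_Units[OF assms] by (simp add: ring_of_type_algebra_def)
  then obtain y where y: "y \<in> L" "y * x = 1"
    by (auto simp: Units_def ring_of_type_algebra_def)
  hence "inverse x = y"
    by (metis inverse_unique mult.commute)
  thus "inverse x \<in> L"
    using y by simp
qed

lemma subfield_power_card_eq_same:
  fixes L :: "'a::field alg_closure set"
  assumes sf: "subfield L closure_ring" and "finite L" and "x \<in> L"
  shows   "x ^ card L = x"
proof (cases "x = 0")
  case False
  note L = subfield_closure_ringD[OF sf]
  have "x * (\<Prod>y\<in>L-{0}. x * y) = x * x ^ (card L - 1) * \<Prod>(L-{0})"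
    using L(2) by (simp add: prod.distrib mult_ac)
  also have "x * x ^ (card L - 1) = x ^ Suc (card L - 1)"
    by simp
  also have "Suc (card L - 1) = card L"
    using assms by (metis Suc_pred' card_gt_0_iff diff_Suc_1 empty_iff)
  also have "(\<Prod>y\<in>L-{0}. x * y) = (\<Prod>y\<in>L-{0}. y)"
    by (rule prod.reindex_bij_witness[of _ "\<lambda>y. inverse x * y" "\<lambda>y. x * y"])
       (use False assms L in auto)
  finally show ?thesis
    using assms by simp
next
  case True
  thus ?thesis
    using assms by (cases "card L") auto
qed

lemma range_to_ac_iff:
  fixes x :: "'a::finite_field alg_closure"
  shows "x \<in> range to_ac \<longleftrightarrow> x ^ CARD('a) = x"
proof -
  define P :: "'a alg_closure poly" where "P = monom 1 CARD('a) - monom 1 1"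
  have card: "CARD('a) > 1"
    using card_mono[of UNIV "{0, 1 :: 'a}"] by simp
  have "coeff P CARD('a) \<noteq> 0"
    using card by (simp add: P_def)
  hence P: "P \<noteq> 0"
    by auto
  have "degree P \<le> CARD('a)"
    unfolding P_def using card by (intro degree_diff_le) (auto simp: degree_monom_eq)
  hence "card {x. poly P x = 0} \<le> card (range (to_ac :: 'a \<Rightarrow> _))"
    using card_poly_roots_bound[OF P] by (simp add: card_image inj_to_ac)
  moreover have "range (to_ac :: 'a \<Rightarrow> _) \<subseteq> {x. poly P x = 0}"
    by (auto simp: P_def poly_monom finite_field_power_card_eq_same simp flip: to_ac_power)
  ultimately have "range (to_ac :: 'a \<Rightarrow> _) = {x. poly P x = 0}"
    using poly_roots_finite[OF P] by (intro card_seteq) auto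
  thus ?thesis
    by (auto simp: P_def poly_monom)
qed

lemma to_ac_characteristic_poly:
  fixes L :: "'a::finite_field alg_closure set"
  assumes "primepow CARD('a)" "subfield L closure_ring" "card L = CARD('a) ^ n" "\<gamma> \<in> L"
  shows   "map_poly to_ac (characteristic_poly n \<gamma>) = conjugate_prod n \<gamma>"
proof -
  let ?q = "CARD('a)"
  define \<phi> :: "'a alg_closure \<Rightarrow> 'a alg_closure" where "\<phi> = (\<lambda>x. x ^ ?q)"
  have prime: "Factorial_Ring.prime CHAR('a)"
    using prime_CHAR_semidom[where ?'a = 'a] finite_imp_CHAR_pos[where ?'a = 'a] by simp
  obtain e where e: "?q = CHAR('a) ^ e"
    using assms(1) CHAR_dvd_CARD[where ?'a = 'a] prime
    by (metis primepow_def prime_dvd_power primes_dvd_imp_eq)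
  have \<phi>_add: "\<phi> (x + y) = \<phi> x + \<phi> y" for x y
    unfolding \<phi>_def by (rule freshmans_dream') (use prime e in auto)
  have \<phi>_0 [simp]: "\<phi> 0 = 0" and \<phi>_1 [simp]: "\<phi> 1 = 1"
    by (auto simp: \<phi>_def)
  have \<phi>_minus: "\<phi> (-x) = -\<phi> x" for x
    using \<phi>_add[of x "-x"] by (simp add: eq_neg_iff_add_eq_0 add.commute)
  have \<phi>_mult: "\<phi> (x * y) = \<phi> x * \<phi> y" for x y
    by (simp add: \<phi>_def power_mult_distrib)
  have \<phi>_sum: "\<phi> (sum f A) = (\<Sum>i\<in>A. \<phi> (f i))" for f and A :: "nat set"
    by (induction A rule: infinite_finite_induct) (auto simp: \<phi>_add)
  have map_mult: "map_poly \<phi> (p * r) = map_poly \<phi> p * map_poly \<phi> r" for p r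
    by (rule poly_eqI) (simp add: coeff_map_poly coeff_mult \<phi>_sum \<phi>_mult)
  have map_prod: "map_poly \<phi> (prod f A) = (\<Prod>i\<in>A. map_poly \<phi> (f i))" for f and A :: "nat set"
    by (induction A rule: infinite_finite_induct) (auto simp: map_mult map_poly_pCons)
  have "card L > 0"
    using assms(3) by simp
  hence "\<gamma> ^ (?q ^ n) = \<gamma>"
    using subfield_power_card_eq_same[OF assms(2) _ assms(4)] assms(3) card_gt_0_iff by metis
  hence cyc: "[:- (\<gamma> ^ (?q ^ n)), 1:] = [:- (\<gamma> ^ (?q ^ 0)), 1:]"
    by simp
  have "map_poly \<phi> (conjugate_prod n \<gamma>) = (\<Prod>i<n. [:- (\<gamma> ^ (?q ^ Suc i)), 1:])"
    unfolding conjugate_prod_def map_prod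
    by (intro prod.cong refl) 
       (simp add: map_poly_pCons \<phi>_minus, simp add: \<phi>_def mult.commute flip: power_mult)
  also have "\<dots> = conjugate_prod n \<gamma>"
  proof (cases n)
    case (Suc m)
    show ?thesis
      using cyc unfolding conjugate_prod_def Suc
      by (subst prod.lessThan_Suc, subst prod.lessThan_Suc_shift) (simp only: mult.commute)
  qed (simp add: conjugate_prod_def)
  finally have "\<phi> (coeff (conjugate_prod n \<gamma>) i) = coeff (conjugate_prod n \<gamma>) i" for i
    by (metis \<phi>_0 coeff_map_poly)
  hence "coeff (conjugate_prod n \<gamma>) i \<in> range to_ac" for i
    by (simp add: range_to_ac_iff \<phi>_def)
  thus ?thesis
    unfolding characteristic_poly_def
    by (intro poly_eqI) (simp add: coeff_map_poly to_ac_of_ac)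
qed

end

theory Submission
  imports Defs
begin

text \<open>
  Both conditions say that every conjugate of \<open>\<gamma> = \<beta> ^ k\<close> is a root of \<open>\<chi>\<close> of multiplicity \<open>t\<close>.
  On the one hand, \<open>m\<close> is the product of the \<open>X - c\<close> over the distinct conjugates \<open>c\<close>. On the
  other hand, \<open>X ^ k - x ^ k\<close> has a simple root at \<open>x\<close> unless \<open>x = 0\<close> and \<open>k > 1\<close>, as \<open>k\<close> is
  nonzero in the field, so the multiplicity of \<open>x\<close> in \<open>\<chi>(X ^ k)\<close> is that of \<open>x ^ k\<close> in \<open>\<chi>\<close>.
  The root \<open>x = 0\<close> occurs only for \<open>\<beta> = 0\<close>, where \<open>k = 1\<close>.
\<close>

section \<open>Polynomials under ring homomorphisms\<close>

text \<open>Serves two maps: the embedding \<open>to_ac\<close> and the Frobenius map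
  \<open>x ^ CARD('a)\<close> on the closure.\<close>

locale comm_semiring_1_hom =
  fixes f :: "'a::comm_semiring_1 \<Rightarrow> 'b::comm_semiring_1"
  assumes zero [simp]: "f 0 = 0"
    and one [simp]: "f 1 = 1"
    and add: "f (x + y) = f x + f y"
    and mult: "f (x * y) = f x * f y"
begin

lemma map_poly_add: "map_poly f (p + r) = map_poly f p + map_poly f r"
  by (rule poly_eqI) (simp add: coeff_map_poly add)

lemma map_poly_mult: "map_poly f (p * r) = map_poly f p * map_poly f r"
proof -
  have "f (sum g A) = (\<Sum>i\<in>A. f (g i))" for g and A :: "nat set"
    by (induction A rule: infinite_finite_induct) (auto simp: add)
  thus ?thesis
    by (intro poly_eqI) (simp add: coeff_map_poly coeff_mult mult)
qed

lemma map_poly_power: "map_poly f (p ^ m) = map_poly f p ^ m"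
  by (induction m) (simp_all add: map_poly_mult)

lemma map_poly_prod: "map_poly f (prod g A) = (\<Prod>i\<in>A. map_poly f (g i))"
  by (induction A rule: infinite_finite_induct) (simp_all add: map_poly_mult)

lemma map_poly_pcompose: "map_poly f (pcompose p r) = pcompose (map_poly f p) (map_poly f r)"
  by (induction p) (simp_all add: pcompose_pCons map_poly_pCons map_poly_add map_poly_mult)

lemma poly_map_poly: "poly (map_poly f p) (f x) = f (poly p x)"
  by (induction p) (simp_all add: map_poly_pCons add mult)

end

lemma comm_semiring_1_hom_to_ac: "comm_semiring_1_hom (to_ac :: 'a::field \<Rightarrow> _)"
  by standard simp_all

lemma inj_map_poly:
  assumes "inj f" "f 0 = 0"
  shows   "inj (map_poly f)"
proof (rule injI)
  fix p r assume "map_poly f p = map_poly f r"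
  hence "f (coeff p i) = f (coeff r i)" for i
    using assms(2) by (metis coeff_map_poly)
  thus "p = r"
    using assms(1) by (intro poly_eqI) (simp add: inj_eq)
qed

section \<open>Multiplicities of roots\<close>

lemma order_power:
  fixes p :: "'a::idom poly"
  assumes "p \<noteq> 0"
  shows   "order a (p ^ m) = m * order a p"
  using assms by (induction m) (simp_all add: order_mult)

lemma order_linear_factor: "order a [:- b, 1:] = (if a = b then 1 else 0)"
  for a b :: "'a::idom"
  using order_power_n_n[of a 1] by (auto intro!: order_0I)

lemma order_prod_linear_factors:
  fixes f :: "'b \<Rightarrow> 'a::idom"
  assumes "finite A"
  shows   "order a (\<Prod>i\<in>A. [:- f i, 1:]) = card {i\<in>A. f i = a}"
  using assms
proof (induction A)
  case (insert j A)
  have "{i \<in> insert j A. f i = a} = (if f j = a then {j} else {}) \<union> {i\<in>A. f i = a}"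
    by auto
  moreover have "(\<Prod>i\<in>A. [:- f i, 1:]) \<noteq> 0"
    using insert.hyps by simp
  ultimately show ?case
    using insert by (simp add: order_mult order_linear_factor del: mult_pCons_left)
qed simp

text \<open>Collecting equal factors writes the left product as the product of
  \<open>[:- c, 1:]\<close> to the power \<open>order c\<close> over the distinct values
  \<open>c\<close>, each of which is a simple root of the product on the right.\<close>

lemma prod_linear_factors_eq_power_iff:
  fixes f :: "'b \<Rightarrow> 'a::idom"
  assumes "finite A"
  shows   "(\<Prod>i\<in>A. [:- f i, 1:]) = (\<Prod>c\<in>f ` A. [:- c, 1:]) ^ t \<longleftrightarrow>
           (\<forall>c\<in>f ` A. order c (\<Prod>i\<in>A. [:- f i, 1:]) = t)"
    (is "?P = ?M ^ t \<longleftrightarrow> _")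
proof
  assume eq: "?P = ?M ^ t"
  show "\<forall>c\<in>f ` A. order c ?P = t"
  proof
    fix c assume "c \<in> f ` A"
    hence "{i \<in> f ` A. i = c} = {c}"
      by auto
    hence "order c ?M = 1"
      using assms order_prod_linear_factors[of "f ` A" c "\<lambda>x. x"] by simp
    moreover have "?M \<noteq> 0"
      using assms by simp
    ultimately show "order c ?P = t"
      by (simp add: eq order_power)
  qed
next
  assume order: "\<forall>c\<in>f ` A. order c ?P = t"
  have "?P = (\<Prod>c\<in>f ` A. \<Prod>i\<in>{i\<in>A. f i = c}. [:- f i, 1:])"
    using assms by (intro prod.group[symmetric]) auto
  also have "\<dots> = (\<Prod>c\<in>f ` A. [:- c, 1:] ^ t)"
  proof (rule prod.cong)
    fix c assume "c \<in> f ` A"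
    hence "card {i\<in>A. f i = c} = t"
      by (subst order_prod_linear_factors[OF assms, symmetric]) (rule order[rule_format])
    moreover have "(\<Prod>i\<in>{i\<in>A. f i = c}. [:- f i, 1:]) = (\<Prod>i\<in>{i\<in>A. f i = c}. [:- c, 1:])"
      by (rule prod.cong) simp_all
    ultimately show "(\<Prod>i\<in>{i\<in>A. f i = c}. [:- f i, 1:]) = [:- c, 1:] ^ t"
      by (simp only: prod_constant)
  qed simp
  finally show "?P = ?M ^ t"
    by (simp add: prod_power_distrib)
qed

text \<open>A double root would also be a root of the derivative, whose value at \<open>x\<close> is
  \<open>k * x ^ (k - 1)\<close>. The assumptions make this nonzero; for \<open>k = 1\<close> it is
  1 even at \<open>x = 0\<close>.\<close>

lemma order_power_minus_const:
  fixes x :: "'a::idom"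
  assumes "of_nat k \<noteq> (0 :: 'a)" "x \<noteq> 0 \<or> k = 1"
  shows   "order x (monom 1 k - [:x ^ k:]) = 1"
proof -
  define p where "p = monom 1 k - [:x ^ k:]"
  have pderiv: "poly (pderiv p) x \<noteq> 0"
    using assms by (auto simp: p_def pderiv_diff pderiv_monom pderiv_pCons poly_monom)
  have "\<not> [:-x, 1:] ^ 2 dvd p"
  proof
    assume "[:-x, 1:] ^ 2 dvd p"
    then obtain r where r: "p = [:-x, 1:] ^ 2 * r" ..
    have "poly (pderiv p) x = 0"
      unfolding r power2_eq_square pderiv_mult poly_add poly_mult by simp
    with pderiv show False
      by simp
  qed
  moreover have "[:-x, 1:] ^ 1 dvd p"
    by (simp add: dvd_iff_poly_eq_0 p_def poly_monom)
  ultimately show ?thesis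
    unfolding p_def by (intro order_unique_lemma) (simp_all add: numeral_2_eq_2)
qed

lemma pcompose_power: "pcompose (p ^ m) r = pcompose p r ^ m"
  for p r :: "'a::comm_semiring_1 poly"
  by (induction m) (simp_all add: pcompose_1 pcompose_mult)

text \<open>Split off from \<open>p\<close> the full power of \<open>X - x ^ k\<close>. Substitution
  turns that factor into \<open>X ^ k - x ^ k\<close>, which has a simple root at \<open>x\<close>,
  and the cofactor stays nonzero at \<open>x\<close>.\<close>

lemma order_pcompose_power:
  fixes x :: "'a::idom"
  assumes "of_nat k \<noteq> (0 :: 'a)" "x \<noteq> 0 \<or> k = 1"
  shows   "order x (pcompose p (monom 1 k)) = order (x ^ k) p"
proof (cases "p = 0")
  case False
  obtain r where r: "p = [:- (x ^ k), 1:] ^ order (x ^ k) p * r" "\<not> [:- (x ^ k), 1:] dvd r"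
    using order_decomp[OF False] by metis
  define g :: "'a poly" where "g = monom 1 k - [:x ^ k:]"
  have "pcompose [:- (x ^ k), 1:] (monom 1 k) = g"
    by (simp add: g_def pcompose_pCons)
  hence "pcompose p (monom 1 k) = g ^ order (x ^ k) p * pcompose r (monom 1 k)"
    by (subst r(1)) (simp add: pcompose_mult pcompose_power)
  moreover have root: "poly (pcompose r (monom 1 k)) x \<noteq> 0"
    using r(2) by (simp add: poly_pcompose poly_monom dvd_iff_poly_eq_0)
  moreover have "order x g = 1"
    unfolding g_def by (rule order_power_minus_const) fact+
  moreover have "coeff g k = 1"
    using assms(1) by (cases k) (auto simp: g_def)
  hence "g \<noteq> 0"
    by auto
  moreover have "pcompose r (monom 1 k) \<noteq> 0"
    using root by auto
  ultimately show ?thesis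
    by (simp add: order_mult order_power order_0I)
\<comment> \<open>For \<open>p = 0\<close> both orders unfold to the same \<open>LEAST\<close> over
  an unsatisfiable predicate, so its value is irrelevant.\<close>
qed (simp add: Polynomial.order_def)

section \<open>Conjugates and the minimal polynomial\<close>

lemma comm_semiring_1_hom_frobenius:
  assumes "primepow CARD('a::finite_field)"
  shows   "comm_semiring_1_hom (\<lambda>x :: 'a alg_closure. x ^ CARD('a))"
proof
  have prime: "Factorial_Ring.prime CHAR('a)"
    using prime_CHAR_semidom[where ?'a = 'a] finite_imp_CHAR_pos[where ?'a = 'a] by simp
  \<comment> \<open>The characteristic is a prime divisor of a prime power, hence its base.\<close>
  obtain e where "CARD('a) = CHAR('a) ^ e"
    using assms CHAR_dvd_CARD[where ?'a = 'a] prime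
    by (metis primepow_def prime_dvd_power primes_dvd_imp_eq)
  thus "(x + y) ^ CARD('a) = x ^ CARD('a) + y ^ CARD('a)" for x y :: "'a alg_closure"
    using prime by (intro freshmans_dream') auto
qed (simp_all add: power_mult_distrib)

text \<open>Frobenius permutes the finite set of conjugates, so their product descends to the base
  field. It has least degree because a polynomial over the base field that vanishes at \<gamma>
  vanishes at every conjugate.\<close>

lemma map_poly_minimal_poly:
  fixes \<gamma> :: "'a::finite_field alg_closure"
  assumes "primepow CARD('a)" "n \<ge> 1" "\<gamma> ^ (CARD('a) ^ n) = \<gamma>"
  shows   "map_poly to_ac (minimal_poly \<gamma>) = (\<Prod>c\<in>(\<lambda>i. \<gamma> ^ (CARD('a) ^ i)) ` {..<n}. [:- c, 1:])"
proof -
  let ?q = "CARD('a)"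
  define C where "C = (\<lambda>i. \<gamma> ^ (?q ^ i)) ` {..<n}"
  define M where "M = (\<Prod>c\<in>C. [:- c, 1:])"
  define \<phi> :: "'a alg_closure \<Rightarrow> 'a alg_closure" where "\<phi> = (\<lambda>x. x ^ ?q)"
  interpret \<phi>: comm_semiring_1_hom \<phi>
    unfolding \<phi>_def by (rule comm_semiring_1_hom_frobenius) fact
  have fin: "finite C"
    by (simp add: C_def)
  have \<gamma>: "\<gamma> \<in> C"
    unfolding C_def using assms(2) by (intro image_eqI[of _ _ 0]) auto
  have \<phi>_minus: "\<phi> (- x) = - \<phi> x" for x
    using \<phi>.add[of x "- x"] by (simp add: eq_neg_iff_add_eq_0 add.commute)
  have "inj \<phi>"
  proof (rule injI)
    fix x y assume "\<phi> x = \<phi> y"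
    hence "\<phi> (x - y) = 0"
      using \<phi>.add[of "x - y" y] by simp
    thus "x = y"
      by (simp add: \<phi>_def)
  qed
  have "\<phi> ` C \<subseteq> C"
  proof
    fix c assume "c \<in> \<phi> ` C"
    then obtain i where i: "i < n" "c = \<gamma> ^ (?q ^ Suc i)"
      by (auto simp: C_def \<phi>_def mult.commute simp flip: power_mult)
    show "c \<in> C"
    proof (cases "Suc i = n")
      case True
      thus ?thesis
        using i(2) assms(3) \<gamma> by simp
    next
      case False
      thus ?thesis
        using i unfolding C_def by (intro image_eqI[of _ _ "Suc i"]) auto
    qed
  qed
  hence \<phi>_C: "\<phi> ` C = C"
    using fin \<open>inj \<phi>\<close> by (intro endo_inj_surj) (auto intro: inj_on_subset)
  have "map_poly \<phi> M = (\<Prod>c\<in>C. [:- \<phi> c, 1:])"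
    unfolding M_def \<phi>.map_poly_prod by (simp add: map_poly_pCons \<phi>_minus)
  also have "\<dots> = (\<Prod>c\<in>\<phi> ` C. [:- c, 1:])"
    using \<open>inj \<phi>\<close> by (subst prod.reindex) (auto intro: inj_on_subset)
  finally have "map_poly \<phi> M = M"
    by (simp add: \<phi>_C M_def)
  hence "\<phi> (coeff M i) = coeff M i" for i
    by (metis \<phi>.zero coeff_map_poly)
  hence "coeff M i \<in> range to_ac" for i
    by (simp add: range_to_ac_iff \<phi>_def)
  \<comment> \<open>\<open>of_ac\<close> is inverted by \<open>to_ac\<close> only on the range of
    \<open>to_ac\<close>, where the coefficients of \<open>M\<close> have just been placed.\<close>
  hence M: "map_poly to_ac (map_poly of_ac M) = M"
    by (intro poly_eqI) (simp add: coeff_map_poly to_ac_of_ac)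
  have deg_M: "degree M = card C"
    unfolding M_def by (subst degree_prod_sum_eq) auto
  have "is_minimal_poly \<gamma> (map_poly of_ac M)"
    unfolding is_minimal_poly_def M
  proof (intro conjI allI impI)
    have "lead_coeff (map_poly to_ac (map_poly of_ac M)) = 1"
      unfolding M by (simp add: M_def lead_coeff_prod)
    hence "to_ac (lead_coeff (map_poly of_ac M)) = to_ac 1"
      by (simp add: coeff_map_poly degree_map_poly)
    thus "lead_coeff (map_poly of_ac M) = 1"
      by (simp only: to_ac_eq_iff)
    show "poly M \<gamma> = 0"
      using \<gamma> fin by (auto simp: M_def poly_prod)
  next
    fix r :: "'a poly"
    assume r: "r \<noteq> 0" "poly (map_poly to_ac r) \<gamma> = 0"
    let ?R = "map_poly to_ac r"
    have "map_poly \<phi> ?R = ?R"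
      by (rule poly_eqI)
         (simp add: coeff_map_poly \<phi>_def finite_field_power_card_eq_same flip: to_ac_power)
    \<comment> \<open>Frobenius fixes the coefficients of \<open>?R\<close>, so it maps roots to
      roots.\<close>
    hence step: "poly ?R (\<phi> x) = \<phi> (poly ?R x)" for x
      using \<phi>.poly_map_poly[of ?R x] by simp
    have "poly ?R (\<gamma> ^ (?q ^ i)) = 0" for i
    proof (induction i)
      case (Suc i)
      thus ?case
        using step[of "\<gamma> ^ (?q ^ i)"] by (simp add: \<phi>_def mult.commute flip: power_mult)
    qed (use r in simp)
    hence "C \<subseteq> {x. poly ?R x = 0}"
      by (auto simp: C_def)
    moreover have "?R \<noteq> 0"
      using r by (simp add: map_poly_eq_0_iff)
    ultimately have "card C \<le> degree ?R"
      using card_mono[OF poly_roots_finite, of ?R C] card_poly_roots_bound[of ?R] by linarith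
    moreover have "degree (map_poly to_ac p) = degree p" for p :: "'a poly"
      by (simp add: degree_map_poly)
    ultimately show "degree (map_poly of_ac M) \<le> degree r"
      using deg_M M by metis
  qed
  hence "minimal_poly \<gamma> = map_poly of_ac M"
    using minimal_poly is_minimal_poly_unique by blast
  thus ?thesis
    using M by (simp add: M_def C_def)
qed

text \<open>For \<beta> = 0 one has \<chi> = \<open>X ^ n\<close> and \<open>m = X\<close>, whereas
  \<chi>(\<open>X ^ k\<close>) is \<open>X ^ (n * k)\<close>. With \<open>k > 1\<close> the
  equivalence then fails at \<open>t = n\<close>, which is why this case is excluded.\<close>

theorem theorem4:
  fixes q n k t :: nat
    and L :: "'a::finite_field alg_closure set"
    and \<beta> :: "'a alg_closure"
  assumes "primepow q" and "CARD('a) = q"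
    and "n \<ge> 1"
    and "subfield L closure_ring" and "card L = q ^ n"
    and "coprime q k"
    and "proper_element \<beta> L"
    and "\<beta> = 0 \<longrightarrow> k = 1"
    and "t > 0"
  shows "characteristic_poly n (\<beta> ^ k) = minimal_poly (\<beta> ^ k) ^ t \<longleftrightarrow>
         (\<forall>x. poly (map_poly to_ac (pcompose (characteristic_poly n (\<beta> ^ k)) (monom 1 k))) x = 0 \<longrightarrow>
              order x (map_poly to_ac (pcompose (characteristic_poly n (\<beta> ^ k)) (monom 1 k))) = t)"
proof -
  interpret to_ac: comm_semiring_1_hom "to_ac :: 'a \<Rightarrow> _"
    by (rule comm_semiring_1_hom_to_ac)
  note L = subfield_closure_ringD[OF assms(4)]
  define \<gamma> where "\<gamma> = \<beta> ^ k"
  define C where "C = (\<lambda>i. \<gamma> ^ (q ^ i)) ` {..<n}"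
  define P where "P = conjugate_prod n \<gamma>"
  have "\<beta> ^ i \<in> L" for i
    using assms(7) L(1,3) by (induction i) (auto simp: proper_element_def)
  hence \<gamma>: "\<gamma> \<in> L"
    by (simp add: \<gamma>_def)
  have q: "q > 1"
    using assms(1) primepow_gt_Suc_0 by simp
  \<comment> \<open>An infinite set has \<open>card\<close> 0, but \<open>q ^ n\<close> is
    positive.\<close>
  hence "finite L"
    using assms(5) by (metis card.infinite power_eq_0_iff not_one_less_zero)
  hence fix_\<gamma>: "\<gamma> ^ (q ^ n) = \<gamma>"
    using subfield_power_card_eq_same[OF assms(4) _ \<gamma>] assms(5) by simp
  have char: "map_poly to_ac (characteristic_poly n \<gamma>) = P"
    unfolding P_def using assms \<gamma> by (intro to_ac_characteristic_poly) auto
  have P: "P = (\<Prod>i<n. [:- (\<gamma> ^ (q ^ i)), 1:])"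
    by (simp add: P_def conjugate_prod_def assms(2))
  hence roots: "poly P c = 0 \<longleftrightarrow> c \<in> C" for c
    by (auto simp: poly_prod C_def)
  have "characteristic_poly n \<gamma> = minimal_poly \<gamma> ^ t \<longleftrightarrow>
          P = map_poly to_ac (minimal_poly \<gamma>) ^ t"
    using inj_map_poly[OF inj_to_ac to_ac_0, THEN inj_eq]
    by (metis char to_ac.map_poly_power)
  also have "map_poly to_ac (minimal_poly \<gamma>) = (\<Prod>c\<in>C. [:- c, 1:])"
    using map_poly_minimal_poly[of n \<gamma>] assms(1-3) fix_\<gamma> by (simp add: C_def)
  also have "P = (\<Prod>c\<in>C. [:- c, 1:]) ^ t \<longleftrightarrow> (\<forall>c\<in>C. order c P = t)"
    unfolding P C_def by (rule prod_linear_factors_eq_power_iff) simp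
  \<comment> \<open>The closure contains a \<open>k\<close>-th root of every element, so each
    conjugate has the form \<open>x ^ k\<close>.\<close>
  also have "\<dots> \<longleftrightarrow> (\<forall>x. x ^ k \<in> C \<longrightarrow> order (x ^ k) P = t)"
  proof -
    have "k > 0"
      using assms(6) q by (cases k) auto
    hence "\<exists>x. x ^ k = c" for c :: "'a alg_closure"
      by (rule nth_root_exists)
    thus ?thesis
      by metis
  qed
  also have "\<dots> \<longleftrightarrow> (\<forall>x. poly (pcompose P (monom 1 k)) x = 0 \<longrightarrow>
                           order x (pcompose P (monom 1 k)) = t)"
  proof -
    have "CHAR('a) \<noteq> 1" "CHAR('a) dvd q"
      using CHAR_dvd_CARD[where ?'a = 'a] assms(2) by auto
    hence "\<not> CHAR('a) dvd k"
      using assms(6) by (metis coprime_common_divisor_nat)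
    hence k: "of_nat k \<noteq> (0 :: 'a alg_closure)"
      by (simp add: of_nat_eq_0_iff_char_dvd)
    \<comment> \<open>Here \<open>k\<close> is positive, so \<open>x = 0\<close> would put 0 among
      the conjugates of \<open>\<beta> ^ k\<close>; this forces \<beta> = 0 and hence
      \<open>k = 1\<close>.\<close>
    have "x \<noteq> 0 \<or> k = 1" if "x ^ k \<in> C" for x
      using that assms(8) k by (cases "k = 0") (auto simp: C_def \<gamma>_def power_0_left)
    hence "order x (pcompose P (monom 1 k)) = order (x ^ k) P" if "x ^ k \<in> C" for x
      using that k by (intro order_pcompose_power) auto
    thus ?thesis
      by (simp add: poly_pcompose poly_monom roots)
  qed
  also have "pcompose P (monom 1 k) =
               map_poly to_ac (pcompose (characteristic_poly n \<gamma>) (monom 1 k))"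
    by (simp add: to_ac.map_poly_pcompose char map_poly_monom)
  finally show ?thesis
    by (simp only: \<gamma>_def)
qed

end
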